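(* Let $X$ be the feature matrix and $\mathbf{y}=\{y_1,\dots,y_n\}$, $y_j\in\mathbb{R}$, $n\ge 1$, the target variable of a training dataset. For an input $\mathbf{x}$, let $\hat y(\mathbf{x})$ be the value predicted by a random forest regression model trained on $X$ and $\mathbf{y}$. Then $$\min(\mathbf{y})\le \hat y(\mathbf{x})\le \max(\mathbf{y})\qquad\text{for every input }\mathbf{x},$$ where $\min(\mathbf{y})=\min_{1\le j\le n}y_j$ and $\max(\mathbf{y})=\max_{1\le j\le n}y_j$.
   Context: A regression tree $t$ trained on $(X,\mathbf{y})$ partitions the input space into finitely many regions, called leaves. Each leaf $l$ contains a nonempty set $L_l\subseteq\{1,\dots,n\}$ of (indices of) training samples, and the prediction attached to the leaf is the mean of their targets, $\hat y_l=\frac{1}{|L_l|}\sum_{j\in L_l}y_j$. The prediction of the tree at $\mathbf{x}$ is the value of the leaf containing $\mathbf{x}$: $\hat y_t(\mathbf{x})=\sum_{l\in\text{leaves}(t)} I(\mathbf{x}\in l)\,\hat y_l$, where $I$ is the indicator function. A random forest regression model consists of $M\ge 1$ such trees, and its prediction is the average $\hat y(\mathbf{x})=\frac1M\sum_{t=1}^M \hat y_t(\mathbf{x})$. *)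

theory Defs
  imports "HOL-Analysis.Analysis" "HOL-Library.Disjoint_Sets"
begin

text \<open>
  The training data are a feature matrix \<open>X\<close> with rows \<open>X 1, \<dots>, X n\<close> and targets
  \<open>y 1, \<dots>, y n\<close>; values outside \<open>{1..n}\<close> are irrelevant. An input is a vector of
  \<open>CARD('p)\<close> features with values in an arbitrary type.

  A tree is given by the partition it induces on the input space: a leaf is its region, and
  \<open>samples t l\<close> is the index set \<open>L\<^sub>l\<close> of the training samples attached to leaf \<open>l\<close>.
\<close>

record ('v, 'p) reg_tree =
  leaves :: "('v ^ 'p) set set"
  samples :: "('v ^ 'p) set \<Rightarrow> nat set"

text \<open>
  The samples attached to a leaf lie in its region, but not every training sample in the region
  need be attached, so that a tree may be grown on a subsample of the training set. No
  particular splitting criterion is fixed; this is why \<open>y\<close> does not occur here.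
\<close>

definition trained_tree ::
    "nat \<Rightarrow> (nat \<Rightarrow> 'v ^ 'p) \<Rightarrow> ('v, 'p) reg_tree \<Rightarrow> bool" where
  "trained_tree n X t \<longleftrightarrow>
     finite (leaves t) \<and> partition_on UNIV (leaves t) \<and>
     (\<forall>l\<in>leaves t. samples t l \<noteq> {} \<and> samples t l \<subseteq> {j\<in>{1..n}. X j \<in> l})"

definition leaf_prediction ::
    "(nat \<Rightarrow> real) \<Rightarrow> ('v, 'p) reg_tree \<Rightarrow> ('v ^ 'p) set \<Rightarrow> real" where
  "leaf_prediction y t l = (\<Sum>j\<in>samples t l. y j) / real (card (samples t l))"

definition tree_prediction ::
    "(nat \<Rightarrow> real) \<Rightarrow> ('v, 'p) reg_tree \<Rightarrow> 'v ^ 'p \<Rightarrow> real" where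
  "tree_prediction y t x = (\<Sum>l\<in>leaves t. indicator l x * leaf_prediction y t l)"

definition random_forest ::
    "nat \<Rightarrow> (nat \<Rightarrow> 'v ^ 'p) \<Rightarrow> nat \<Rightarrow> (nat \<Rightarrow> ('v, 'p) reg_tree) \<Rightarrow> bool" where
  "random_forest n X M T \<longleftrightarrow> M \<ge> 1 \<and> (\<forall>t\<in>{1..M}. trained_tree n X (T t))"

definition forest_prediction ::
    "(nat \<Rightarrow> real) \<Rightarrow> nat \<Rightarrow> (nat \<Rightarrow> ('v, 'p) reg_tree) \<Rightarrow> 'v ^ 'p \<Rightarrow> real" where
  "forest_prediction y M T x = (\<Sum>t=1..M. tree_prediction y (T t) x) / real M"

end

theory Submission imports Defs begin

text \<open>An interval is convex, so it contains the mean of any finite nonempty family of its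
  points (\<open>mean_in_Icc\<close>). This is used twice with the interval from the least to the
  greatest target: a leaf value is a mean of targets, and the forest value is a mean of tree values.
  In between, the leaves partition the input space, so a tree's value at \<open>x\<close> is the
  value of a single leaf (\<open>tree_prediction_eq_leaf_prediction\<close>).\<close>

lemma mean_in_Icc:
  fixes f :: "'a \<Rightarrow> real"
  assumes "finite A" "A \<noteq> {}" "f ` A \<subseteq> {a..b}"
  shows "sum f A / real (card A) \<in> {a..b}"
proof -
  \<comment> \<open>Positivity lets the division be cleared from both bounds; for
    \<open>card A = 0\<close> the quotient would be the default value 0, which may lie outside the
    interval.\<close>
  have "card A > 0"
    using assms by (simp add: card_gt_0_iff)
  moreover have "sum f A \<le> real (card A) * b"
    using assms(3) by (intro sum_bounded_above) auto
  moreover have "real (card A) * a \<le> sum f A"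
    using assms(3) by (intro sum_bounded_below) auto
  ultimately show ?thesis
    by (simp add: field_simps)
qed

lemma leaf_prediction_in_Icc:
  assumes "trained_tree n X t" "l \<in> leaves t"
  shows "leaf_prediction y t l \<in> {Min (y ` {1..n})..Max (y ` {1..n})}"
proof -
  have L: "samples t l \<noteq> {}" "samples t l \<subseteq> {1..n}"
    using assms unfolding trained_tree_def by blast+
  then have "y ` samples t l \<subseteq> {Min (y ` {1..n})..Max (y ` {1..n})}"
    by (auto intro!: Min_le Max_ge)
  with L show ?thesis
    unfolding leaf_prediction_def by (intro mean_in_Icc finite_subset[OF L(2)]) auto
qed

text \<open>By disjointness no leaf other than \<open>l\<close> contains \<open>x\<close>, so the
  indicators leave one summand.\<close>

lemma tree_prediction_eq_leaf_prediction:
  assumes "finite (leaves t)" "partition_on UNIV (leaves t)" "l \<in> leaves t" "x \<in> l"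
  shows "tree_prediction y t x = leaf_prediction y t l"
proof -
  have "x \<in> k \<longleftrightarrow> k = l" if "k \<in> leaves t" for k
    using assms that by (auto simp: partition_on_def disjoint_def)
  then have "tree_prediction y t x = (\<Sum>k\<in>leaves t. if k = l then leaf_prediction y t k else 0)"
    unfolding tree_prediction_def by (intro sum.cong) (auto simp: indicator_def)
  also have "\<dots> = leaf_prediction y t l"
    using assms by simp
  finally show ?thesis .
qed

lemma tree_prediction_in_Icc:
  assumes "trained_tree n X t"
  shows "tree_prediction y t x \<in> {Min (y ` {1..n})..Max (y ` {1..n})}"
proof -
  have t: "finite (leaves t)" "partition_on UNIV (leaves t)"
    using assms by (auto simp: trained_tree_def)
  \<comment> \<open>The leaves cover the whole space, so no input falls back to the empty sum
    0.\<close>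
  obtain l where l: "l \<in> leaves t" "x \<in> l"
    using partition_onD1[OF t(2)] by blast
  show ?thesis
    unfolding tree_prediction_eq_leaf_prediction[OF t l]
    by (rule leaf_prediction_in_Icc[OF assms l(1)])
qed

theorem proposition1:
  fixes n M :: nat
    and X :: "nat \<Rightarrow> 'v ^ 'p"
    and y :: "nat \<Rightarrow> real"
    and T :: "nat \<Rightarrow> ('v, 'p) reg_tree"
  assumes "n \<ge> 1"
    and "random_forest n X M T"
  shows "\<forall>x. Min (y ` {1..n}) \<le> forest_prediction y M T x \<and>
             forest_prediction y M T x \<le> Max (y ` {1..n})"
proof
  fix x
  have M: "M \<ge> 1" and trees: "\<And>t. t \<in> {1..M} \<Longrightarrow> trained_tree n X (T t)"
    using assms(2) by (auto simp: random_forest_def)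
  \<comment> \<open>Writing \<open>M\<close> as \<open>card {1..M}\<close> makes the forest
    prediction a mean over a set of trees, nonempty because \<open>M \<ge> 1\<close>.\<close>
  have "(\<Sum>t\<in>{1..M}. tree_prediction y (T t) x) / real (card {1..M})
      \<in> {Min (y ` {1..n})..Max (y ` {1..n})}"
    using M trees by (intro mean_in_Icc image_subsetI tree_prediction_in_Icc) auto
  then show "Min (y ` {1..n}) \<le> forest_prediction y M T x \<and>
      forest_prediction y M T x \<le> Max (y ` {1..n})"
    by (simp add: forest_prediction_def)
qed

end
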